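(* Let $s,t\in[1,+\infty)$ with $s>t$, and let $w=(w_m)_{m\in\mathbb{Z}}$ and $\hat w=(\hat w_m)_{m\in\mathbb{Z}}$ be two sequences of real weights with $w_m>0$ and $\hat w_m>0$ for every $m\in\mathbb{Z}$. Assume that there exist finite constants $c_1,c_2>0$, independent of $m$, such that $$c_1\le\frac{w_m^{t/s}}{\hat w_m}\le c_2\qquad\text{for every } m\in\mathbb{Z},$$ and let $k\in\left(\frac{s-t}{st},+\infty\right)$. Then there exist the embeddings $$h^{k,s}_{\mathbb{C},w}\to l^{t}_{\mathbb{C},\hat w}\to l^{s}_{\mathbb{C},w},$$ where the first one is compact and the second one is continuous.
   Context: For $s\in[1,+\infty)$, $k\in\mathbb{R}$ and a sequence of weights $w=(w_m)_{m\in\mathbb{Z}}$ with $w_m>0$ for every $m$, $h^{k,s}_{\mathbb{C},w}$ denotes the Banach space of all complex sequences $p=(p_m)_{m\in\mathbb{Z}}$ with $$\|p\|_{k,s,w}:=\Big(\sum_{m\in\mathbb{Z}}w_m(1+|m|^s)^k|p_m|^s\Big)^{1/s}<+\infty,$$ with the usual componentwise algebraic operations and this norm. For $k=0$ one writes $l^s_{\mathbb{C},w}:=h^{0,s}_{\mathbb{C},w}$, with norm $\|p\|_{s,w}=\big(\sum_{m\in\mathbb{Z}}w_m|p_m|^s\big)^{1/s}$; thus $l^t_{\mathbb{C},\hat w}$ has norm $\big(\sum_{m\in\mathbb{Z}}\hat w_m|p_m|^t\big)^{1/t}$. An embedding $X\to Y$ between two such spaces means that $X\subseteq Y$ as sets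 of sequences and that the inclusion map $p\mapsto p$ is a continuous linear map from $X$ to $Y$; it is compact if the inclusion map is a compact operator. *)

theory Defs
  imports "HOL-Analysis.Analysis"
begin

text \<open>
  Since the spaces depend on the real parameters \<open>k\<close>, \<open>s\<close> and on the weight \<open>w\<close>, a normed space of
  two-sided complex sequences is represented by its carrier together with its norm; the algebraic
  operations are the componentwise ones.
\<close>

type_synonym cseq = "int \<Rightarrow> complex"

record seq_space =
  seqs :: "cseq set"
  seq_norm :: "cseq \<Rightarrow> real"

definition seq_dist :: "seq_space \<Rightarrow> cseq \<Rightarrow> cseq \<Rightarrow> real" where
  "seq_dist X p q = seq_norm X (\<lambda>m. p m - q m)"

definition seq_topology :: "seq_space \<Rightarrow> cseq topology" where
  "seq_topology X = Metric_space.mtopology (seqs X) (seq_dist X)"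

definition linear_operator :: "seq_space \<Rightarrow> seq_space \<Rightarrow> (cseq \<Rightarrow> cseq) \<Rightarrow> bool" where
  "linear_operator X Y T \<longleftrightarrow>
     T \<in> seqs X \<rightarrow> seqs Y \<and>
     (\<forall>p\<in>seqs X. \<forall>q\<in>seqs X. T (\<lambda>m. p m + q m) = (\<lambda>m. T p m + T q m)) \<and>
     (\<forall>a. \<forall>p\<in>seqs X. T (\<lambda>m. a * p m) = (\<lambda>m. a * T p m))"

definition continuous_linear_operator ::
    "seq_space \<Rightarrow> seq_space \<Rightarrow> (cseq \<Rightarrow> cseq) \<Rightarrow> bool" where
  "continuous_linear_operator X Y T \<longleftrightarrow>
     linear_operator X Y T \<and> continuous_map (seq_topology X) (seq_topology Y) T"

definition seq_bounded :: "seq_space \<Rightarrow> cseq set \<Rightarrow> bool" where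
  "seq_bounded X B \<longleftrightarrow> B \<subseteq> seqs X \<and> (\<exists>C. \<forall>p\<in>B. seq_norm X p \<le> C)"

definition compact_operator :: "seq_space \<Rightarrow> seq_space \<Rightarrow> (cseq \<Rightarrow> cseq) \<Rightarrow> bool" where
  "compact_operator X Y T \<longleftrightarrow>
     linear_operator X Y T \<and>
     (\<forall>B. seq_bounded X B \<longrightarrow> compactin (seq_topology Y) (seq_topology Y closure_of (T ` B)))"

definition continuous_embedding :: "seq_space \<Rightarrow> seq_space \<Rightarrow> bool" where
  "continuous_embedding X Y \<longleftrightarrow>
     seqs X \<subseteq> seqs Y \<and> continuous_linear_operator X Y (\<lambda>p. p)"

definition compact_embedding :: "seq_space \<Rightarrow> seq_space \<Rightarrow> bool" where
  "compact_embedding X Y \<longleftrightarrow>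
     continuous_embedding X Y \<and> compact_operator X Y (\<lambda>p. p)"

text \<open>
  As \<open>0 powr a = 0\<close>, the term \<open>\<bar>m\<bar>\<^sup>s\<close> at \<open>m = 0\<close> and the terms \<open>\<bar>p m\<bar>\<^sup>s\<close> with \<open>p m = 0\<close> have their
  usual value \<open>0\<close> for \<open>s > 0\<close>. All summands are nonnegative, so finiteness of the sum is
  summability; \<open>infsum\<close> alone would be \<open>0\<close> on divergent sums.
\<close>

definition h_term :: "real \<Rightarrow> real \<Rightarrow> (int \<Rightarrow> real) \<Rightarrow> cseq \<Rightarrow> int \<Rightarrow> real" where
  "h_term k s w p m = w m * (1 + \<bar>real_of_int m\<bar> powr s) powr k * cmod (p m) powr s"

definition h_space :: "real \<Rightarrow> real \<Rightarrow> (int \<Rightarrow> real) \<Rightarrow> seq_space" where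
  "h_space k s w =
     \<lparr>seqs = {p. h_term k s w p summable_on UNIV},
      seq_norm = (\<lambda>p. (\<Sum>\<^sub>\<infinity>m. h_term k s w p m) powr (1 / s))\<rparr>"

definition l_space :: "real \<Rightarrow> (int \<Rightarrow> real) \<Rightarrow> seq_space" where
  "l_space s w = h_space 0 s w"

lemma l_space_eq:
  "l_space s w =
     \<lparr>seqs = {p. (\<lambda>m. w m * cmod (p m) powr s) summable_on UNIV},
      seq_norm = (\<lambda>p. (\<Sum>\<^sub>\<infinity>m. w m * cmod (p m) powr s) powr (1 / s))\<rparr>"
proof -
  have "1 + \<bar>real_of_int m\<bar> powr s \<noteq> 0" for m :: int
    using powr_ge_zero[of "\<bar>real_of_int m\<bar>" s] by linarith
  hence "h_term 0 s w p = (\<lambda>m. w m * cmod (p m) powr s)" for p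
    by (simp add: h_term_def fun_eq_iff)
  thus ?thesis
    by (simp add: l_space_def h_space_def)
qed

text \<open>
  The remaining lemmas show that \<open>h_space k s w\<close> is a normed vector space, so that
  \<open>seq_topology\<close> is its norm topology.
\<close>

lemma convex_powr_bound:
  fixes x y u v s :: real
  assumes "x \<ge> 0" "y \<ge> 0" "u \<ge> 0" "v \<ge> 0" "u + v = 1" "s \<ge> 1"
  shows "(u * x + v * y) powr s \<le> u * x powr s + v * y powr s"
proof -
  have small: "a powr s \<le> a" if "0 \<le> a" "a \<le> 1" for a :: real
    using that powr_mono'[of 1 s a] \<open>s \<ge> 1\<close> by (cases "a = 0") auto
  have one: "(a * z) powr s \<le> a * z powr s" if "0 \<le> a" "a \<le> 1" "z \<ge> 0" for a z :: real
    using that small[of a] by (simp add: powr_mult mult_right_mono)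
  consider "x = 0" | "y = 0" | "x > 0" "y > 0" using assms by linarith
  then show ?thesis
  proof cases
    case 1
    then show ?thesis using one[of v y] assms by simp
  next
    case 2
    then show ?thesis using one[of u x] assms by simp
  next
    case 3
    have "convex_on {0<..} (\<lambda>z::real. z powr s)"
      by (rule powr_convex) (use assms in auto)
    from convex_onD[OF this, of v x y] 3 assms
    have "((1 - v) * x + v * y) powr s \<le> (1 - v) * x powr s + v * y powr s"
      by simp
    moreover have "1 - v = u" using assms by linarith
    ultimately show ?thesis by (simp only:)
  qed
qed

context
  fixes k s :: real and w :: "int \<Rightarrow> real"
  assumes s: "s \<ge> 1" and w: "\<And>m. w m > 0"
begin

definition h_wt :: "int \<Rightarrow> real" where
  "h_wt m = w m * (1 + \<bar>real_of_int m\<bar> powr s) powr k"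

lemma h_wt_pos: "h_wt m > 0"
proof -
  have "1 + \<bar>real_of_int m\<bar> powr s > 0"
    using powr_ge_zero[of "\<bar>real_of_int m\<bar>" s] by linarith
  thus ?thesis
    using w[of m] by (simp add: h_wt_def)
qed

lemma h_term_wt: "h_term k s w p m = h_wt m * cmod (p m) powr s"
  by (simp add: h_term_def h_wt_def)

lemma h_term_nonneg: "h_term k s w p m \<ge> 0"
  using h_wt_pos[of m] by (simp add: h_term_wt)

lemma h_seqs_iff: "p \<in> seqs (h_space k s w) \<longleftrightarrow> h_term k s w p summable_on UNIV"
  by (simp add: h_space_def)

lemma h_norm_nonneg: "seq_norm (h_space k s w) p \<ge> 0"
  by (simp add: h_space_def)

lemma h_norm_powr: "seq_norm (h_space k s w) p powr s = (\<Sum>\<^sub>\<infinity>m. h_term k s w p m)"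
  using s infsum_nonneg[of UNIV "h_term k s w p"] h_term_nonneg
  by (simp add: h_space_def powr_powr)

lemma h_norm_eq_0_iff:
  assumes "p \<in> seqs (h_space k s w)"
  shows "seq_norm (h_space k s w) p = 0 \<longleftrightarrow> p = (\<lambda>m. 0)"
proof
  assume "seq_norm (h_space k s w) p = 0"
  hence 0: "(\<Sum>\<^sub>\<infinity>m. h_term k s w p m) = 0"
    using h_norm_powr[of p] by simp
  have "h_term k s w p m = 0" for m
    by (rule nonneg_infsum_le_0D[of "h_term k s w p" UNIV])
       (use 0 assms h_term_nonneg in \<open>auto simp: h_seqs_iff\<close>)
  thus "p = (\<lambda>m. 0)"
    using h_wt_pos by (auto simp: h_term_wt fun_eq_iff less_le)
next
  assume "p = (\<lambda>m. 0)"
  thus "seq_norm (h_space k s w) p = 0"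
    by (simp add: h_space_def h_term_def)
qed

lemma h_term_scale: "h_term k s w (\<lambda>m. a * p m) m = cmod a powr s * h_term k s w p m"
  by (simp add: h_term_wt norm_mult powr_mult)

lemma h_scale:
  assumes "p \<in> seqs (h_space k s w)"
  shows "(\<lambda>m. a * p m) \<in> seqs (h_space k s w)"
    and "seq_norm (h_space k s w) (\<lambda>m. a * p m) = cmod a * seq_norm (h_space k s w) p"
proof -
  have eq: "h_term k s w (\<lambda>m. a * p m) = (\<lambda>m. cmod a powr s * h_term k s w p m)"
    by (simp add: h_term_scale fun_eq_iff)
  show "(\<lambda>m. a * p m) \<in> seqs (h_space k s w)"
    using assms by (auto simp: h_seqs_iff eq intro: summable_on_cmult_right)
  show "seq_norm (h_space k s w) (\<lambda>m. a * p m) = cmod a * seq_norm (h_space k s w) p"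
    using s infsum_nonneg[of UNIV "h_term k s w p"] h_term_nonneg
    by (simp add: h_space_def eq infsum_cmult_right' powr_mult powr_powr)
qed

lemma h_zero: "(\<lambda>m. 0) \<in> seqs (h_space k s w)"
  by (simp add: h_seqs_iff h_term_def[abs_def])

lemma h_term_convex:
  assumes "a > 0" "b > 0"
  shows "h_term k s w (\<lambda>m. p m + q m) m
    \<le> (a + b) powr s * (a / (a + b) * (h_term k s w p m / a powr s)
        + b / (a + b) * (h_term k s w q m / b powr s))"
proof -
  let ?x = "cmod (p m) / a" and ?y = "cmod (q m) / b"
  have "cmod (p m + q m) \<le> cmod (p m) + cmod (q m)" by (rule norm_triangle_ineq)
  also have "\<dots> = (a + b) * (a / (a + b) * ?x + b / (a + b) * ?y)"
  proof -
    have "(a + b) * (a / (a + b) * ?x) = cmod (p m)" "(a + b) * (b / (a + b) * ?y) = cmod (q m)"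
      using assms by auto
    thus ?thesis by (simp only: distrib_left)
  qed
  finally have "cmod (p m + q m) powr s
      \<le> ((a + b) * (a / (a + b) * ?x + b / (a + b) * ?y)) powr s"
    using s by (intro powr_mono2) auto
  also have "\<dots> = (a + b) powr s * (a / (a + b) * ?x + b / (a + b) * ?y) powr s"
    using assms by (simp add: powr_mult)
  also have "\<dots> \<le> (a + b) powr s * (a / (a + b) * ?x powr s + b / (a + b) * ?y powr s)"
    using assms s
    by (intro mult_left_mono convex_powr_bound) (auto simp: add_divide_distrib[symmetric])
  finally have *: "cmod (p m + q m) powr s \<le>
    (a + b) powr s * (a / (a + b) * ?x powr s + b / (a + b) * ?y powr s)" .
  have "h_wt m * cmod (p m + q m) powr s \<le>
     h_wt m * ((a + b) powr s * (a / (a + b) * ?x powr s + b / (a + b) * ?y powr s))"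
    using * h_wt_pos[of m] by (intro mult_left_mono) auto
  thus ?thesis
    using assms by (simp add: h_term_wt powr_divide algebra_simps)
qed

lemma h_add_aux:
  assumes p: "p \<in> seqs (h_space k s w)" and q: "q \<in> seqs (h_space k s w)"
    and ab: "a > 0" "b > 0"
    and le: "seq_norm (h_space k s w) p \<le> a" "seq_norm (h_space k s w) q \<le> b"
  shows "(\<lambda>m. p m + q m) \<in> seqs (h_space k s w)"
    and "seq_norm (h_space k s w) (\<lambda>m. p m + q m) \<le> a + b"
proof -
  let ?P = "h_term k s w p" and ?Q = "h_term k s w q" and ?R = "h_term k s w (\<lambda>m. p m + q m)"
  define \<alpha> \<beta> where "\<alpha> = (a + b) powr s * (a / (a + b)) / a powr s"
    and "\<beta> = (a + b) powr s * (b / (a + b)) / b powr s"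
  have pq: "?P summable_on UNIV" "?Q summable_on UNIV" using p q by (auto simp: h_seqs_iff)
  have R: "?R m \<le> \<alpha> * ?P m + \<beta> * ?Q m" for m
    using h_term_convex[OF ab, of p q m] by (simp add: \<alpha>_def \<beta>_def algebra_simps)
  have S: "(\<lambda>m. \<alpha> * ?P m + \<beta> * ?Q m) summable_on UNIV"
    by (intro summable_on_add summable_on_cmult_right pq)
  have sR: "?R summable_on UNIV"
    by (rule summable_on_comparison_test[OF S]) (use R h_term_nonneg in auto)
  thus "(\<lambda>m. p m + q m) \<in> seqs (h_space k s w)"
    by (simp add: h_seqs_iff)
  have P: "infsum ?P UNIV \<le> a powr s" and Q: "infsum ?Q UNIV \<le> b powr s"
    using powr_mono2[OF _ h_norm_nonneg le(1), of s] powr_mono2[OF _ h_norm_nonneg le(2), of s] s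
    by (simp_all add: h_norm_powr)
  have "infsum ?R UNIV \<le> (\<Sum>\<^sub>\<infinity>m. \<alpha> * ?P m + \<beta> * ?Q m)"
    by (intro infsum_mono sR S R)
  also have "\<dots> = \<alpha> * infsum ?P UNIV + \<beta> * infsum ?Q UNIV"
    by (simp add: infsum_add summable_on_cmult_right pq infsum_cmult_right')
  also have "\<dots> \<le> \<alpha> * a powr s + \<beta> * b powr s"
    using P Q ab by (intro add_mono mult_left_mono) (auto simp: \<alpha>_def \<beta>_def)
  also have "\<dots> = (a + b) powr s * (a / (a + b) + b / (a + b))"
    using ab by (simp add: \<alpha>_def \<beta>_def distrib_left)
  also have "\<dots> = (a + b) powr s"
    using ab by (simp add: add_divide_distrib[symmetric])
  finally have "infsum ?R UNIV powr (1 / s) \<le> ((a + b) powr s) powr (1 / s)"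
    using s h_term_nonneg by (intro powr_mono2 infsum_nonneg) auto
  thus "seq_norm (h_space k s w) (\<lambda>m. p m + q m) \<le> a + b"
    using s ab by (simp add: h_space_def powr_powr)
qed

lemma h_add:
  assumes "p \<in> seqs (h_space k s w)" and "q \<in> seqs (h_space k s w)"
  shows "(\<lambda>m. p m + q m) \<in> seqs (h_space k s w)"
    and "seq_norm (h_space k s w) (\<lambda>m. p m + q m)
      \<le> seq_norm (h_space k s w) p + seq_norm (h_space k s w) q"
proof -
  let ?n = "seq_norm (h_space k s w)"
  have pos: "?n r + e > 0" if "e > 0" for r e
    using h_norm_nonneg[of r] that by linarith
  show "(\<lambda>m. p m + q m) \<in> seqs (h_space k s w)"
    by (rule h_add_aux(1)[OF assms pos[of 1 p] pos[of 1 q]]) auto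
  show "?n (\<lambda>m. p m + q m) \<le> ?n p + ?n q"
  proof (rule field_le_epsilon)
    fix e :: real assume e: "e > 0"
    have "?n (\<lambda>m. p m + q m) \<le> (?n p + e / 2) + (?n q + e / 2)"
      by (rule h_add_aux(2)[OF assms pos[of "e / 2" p] pos[of "e / 2" q]]) (use e in auto)
    thus "?n (\<lambda>m. p m + q m) \<le> ?n p + ?n q + e" by simp
  qed
qed

lemma h_diff:
  assumes "p \<in> seqs (h_space k s w)" and "q \<in> seqs (h_space k s w)"
  shows "(\<lambda>m. p m - q m) \<in> seqs (h_space k s w)"
  using h_add(1)[OF assms(1) h_scale(1)[OF assms(2), of "-1"]] by simp

lemma h_Metric_space: "Metric_space (seqs (h_space k s w)) (seq_dist (h_space k s w))"
proof
  fix x y z :: cseq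
  show "0 \<le> seq_dist (h_space k s w) x y"
    by (simp add: seq_dist_def h_norm_nonneg)
  show "seq_dist (h_space k s w) x y = seq_dist (h_space k s w) y x"
    by (simp add: seq_dist_def h_space_def h_term_def norm_minus_commute)
  assume x: "x \<in> seqs (h_space k s w)" and y: "y \<in> seqs (h_space k s w)"
  show "seq_dist (h_space k s w) x y = 0 \<longleftrightarrow> x = y"
    using h_norm_eq_0_iff[OF h_diff[OF x y]] by (simp add: seq_dist_def fun_eq_iff)
  assume z: "z \<in> seqs (h_space k s w)"
  show "seq_dist (h_space k s w) x z \<le> seq_dist (h_space k s w) x y + seq_dist (h_space k s w) y z"
    using h_add(2)[OF h_diff[OF x y] h_diff[OF y z]] by (simp add: seq_dist_def)
qed

end

end

theory Submission
  imports Defs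
begin

text \<open>
  Put \<open>\<theta> = t / s\<close>. Up to the constant \<open>1 / c\<^sub>1\<close>, the summand \<open>w' m * \<bar>p m\<bar>\<^sup>t\<close> of the target norm is at
  most \<open>x m powr \<theta> * y m powr (1 - \<theta>)\<close>, where \<open>x m\<close> is the summand of the source norm and
  \<open>y m = (1 + \<bar>m\<bar>\<^sup>s) powr (- k * t / (s - t))\<close> is summable precisely because \<open>k > (s - t) / (s * t)\<close>.
  Young's inequality with a small parameter in place of the Hoelder inequality bounds this pointwise by
  \<open>\<epsilon> * x m + c\<^sub>\<epsilon> * y m\<close>. Hence the tails in the target norm are uniformly small on balls of the source,
  and a pointwise convergent subsequence, which exists by Tychonoff, converges in the target norm.
  The second embedding is the inclusion of \<open>l\<^sup>t\<close> in \<open>l\<^sup>s\<close> for the sequence \<open>w m powr (1 / s) * p m\<close>.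
\<close>

section \<open>Continuity of an inclusion from a bound on the unit ball\<close>

text \<open>By homogeneity, a bound for the target sum on the unit ball of the source rescales to
  every ball. Applied to differences, this makes the inclusion Lipschitz, so each embedding reduces
  to an estimate of sums under the normalization \<open>\<le> 1\<close>.\<close>

lemma h_continuous_embeddingI:
  fixes s t k l M :: real and w w' :: "int \<Rightarrow> real"
  assumes s: "s \<ge> 1" and t: "t \<ge> 1" and w: "\<And>m. w m > 0" and w': "\<And>m. w' m > 0"
    and bound: "\<And>p. p \<in> seqs (h_space k s w) \<Longrightarrow> (\<Sum>\<^sub>\<infinity>m. h_term k s w p m) \<le> 1
      \<Longrightarrow> p \<in> seqs (h_space l t w') \<and> (\<Sum>\<^sub>\<infinity>m. h_term l t w' p m) \<le> M"
  shows "continuous_embedding (h_space k s w) (h_space l t w')"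
proof -
  let ?X = "h_space k s w" and ?Y = "h_space l t w'"
  interpret X: Metric_space "seqs ?X" "seq_dist ?X" by (rule h_Metric_space[where w = w, OF s w])
  interpret Y: Metric_space "seqs ?Y" "seq_dist ?Y" by (rule h_Metric_space[where w = w', OF t w'])
  \<comment> \<open>\<open>M\<close> carries no sign assumption, hence the absolute value. The
    summand 1 makes \<open>N\<close> positive, so that \<open>\<epsilon> / N\<close> is a valid
    radius, and turns the norm bound into a strict one.\<close>
  define N where "N = \<bar>M\<bar> powr (1 / t) + 1"
  have N: "N > 0" by (simp add: N_def add_nonneg_pos)
  have ball: "p \<in> seqs ?Y \<and> seq_norm ?Y p < N * r"
    if p: "p \<in> seqs ?X" and r: "r > 0" "seq_norm ?X p \<le> r" for p r
  proof -
    define q where "q = (\<lambda>m. complex_of_real (1 / r) * p m)"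
    have q: "q \<in> seqs ?X" "seq_norm ?X q = 1 / r * seq_norm ?X p"
      using h_scale[where w = w, OF s w p, of "complex_of_real (1 / r)"] r(1) by (simp_all add: q_def norm_divide)
    have "seq_norm ?X q \<le> 1" using q(2) r by simp
    hence "(\<Sum>\<^sub>\<infinity>m. h_term k s w q m) \<le> 1"
      using powr_mono2[of s "seq_norm ?X q" 1] s h_norm_nonneg[where w = w, OF s w, of k q]
      by (simp add: h_norm_powr[where w = w, OF s w])
    from bound[OF q(1) this] have qY: "q \<in> seqs ?Y" and le: "(\<Sum>\<^sub>\<infinity>m. h_term l t w' q m) \<le> M" by auto
    have "(\<Sum>\<^sub>\<infinity>m. h_term l t w' q m) powr (1 / t) \<le> \<bar>M\<bar> powr (1 / t)"
      using le t by (intro powr_mono2 infsum_nonneg h_term_nonneg[where w = w', OF t w']) auto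
    hence qn: "seq_norm ?Y q < N" by (simp add: h_space_def N_def)
    have p_eq: "p = (\<lambda>m. complex_of_real r * q m)"
      using r by (simp add: q_def fun_eq_iff)
    show ?thesis
      using h_scale[where w = w', OF t w' qY, of "complex_of_real r"] qn r
      by (simp add: p_eq[symmetric] mult.commute)
  qed
  \<comment> \<open>The radius is the norm plus 1, since \<open>ball\<close> asks for a positive
    radius and the norm may be 0.\<close>
  have sub: "p \<in> seqs ?Y" if "p \<in> seqs ?X" for p
    using ball[OF that, of "seq_norm ?X p + 1"] h_norm_nonneg[where w = w, OF s w, of k p] by simp
  have "continuous_map (seq_topology ?X) (seq_topology ?Y) (\<lambda>p. p)"
    unfolding seq_topology_def X.metric_continuous_map[OF Y.Metric_space_axioms]
  proof (intro conjI ballI allI impI)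
    fix p and \<epsilon> :: real assume p: "p \<in> seqs ?X" and \<epsilon>: "\<epsilon> > 0"
    have "seq_dist ?Y p q < \<epsilon>" if "q \<in> seqs ?X" "seq_dist ?X p q < \<epsilon> / N" for q
      using ball[OF h_diff[where w = w, OF s w p that(1)], of "\<epsilon> / N"] that(2) \<epsilon> N by (simp add: seq_dist_def)
    thus "\<exists>\<delta>>0. \<forall>q. q \<in> seqs ?X \<and> seq_dist ?X p q < \<delta> \<longrightarrow> seq_dist ?Y p q < \<epsilon>"
      using \<epsilon> N by (intro exI[of _ "\<epsilon> / N"]) auto
  qed (use sub in auto)
  thus ?thesis
    using sub by (auto simp: continuous_embedding_def continuous_linear_operator_def linear_operator_def)
qed

section \<open>Vanishing sums, pointwise limits and compactness\<close>

text \<open>A variant of dominated convergence in which part of the majorant moves with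
  \<open>n\<close>: the moving part \<open>x n\<close> has bounded mass and an arbitrarily small
  coefficient, and the fixed part \<open>y\<close> has small tails. Only a finite set of indices
  remains, where pointwise convergence suffices.\<close>

lemma infsum_tendsto_zero_of_domination:
  fixes f x :: "nat \<Rightarrow> 'a \<Rightarrow> real" and y :: "'a \<Rightarrow> real" and Q :: real
  assumes f: "\<And>n m. f n m \<ge> 0" and fs: "\<And>n. f n summable_on UNIV"
    and x: "\<And>n m. x n m \<ge> 0" and xs: "\<And>n. x n summable_on UNIV"
    and xQ: "\<And>n. (\<Sum>\<^sub>\<infinity>m. x n m) \<le> Q"
    and y: "\<And>m. y m \<ge> 0" and ys: "y summable_on UNIV"
    and dom: "\<And>\<epsilon>. \<epsilon> > 0 \<Longrightarrow> \<exists>c\<ge>0. \<forall>n m. f n m \<le> \<epsilon> * x n m + c * y m"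
    and lim: "\<And>m. (\<lambda>n. f n m) \<longlonglongrightarrow> 0"
  shows "(\<lambda>n. \<Sum>\<^sub>\<infinity>m. f n m) \<longlonglongrightarrow> 0"
proof (rule order_tendstoI)
  fix e :: real assume "e < 0"
  moreover have "(\<Sum>\<^sub>\<infinity>m. f n m) \<ge> 0" for n by (rule infsum_nonneg) (rule f)
  ultimately show "\<forall>\<^sub>F n in sequentially. e < (\<Sum>\<^sub>\<infinity>m. f n m)"
    by (intro always_eventually allI) (rule less_le_trans)
next
  fix e :: real assume e: "e > 0"
  have Q: "Q \<ge> 0" using infsum_nonneg[of UNIV "x 0"] x xQ[of 0] by force
  \<comment> \<open>The target \<open>e\<close> is split into thirds: the moving majorant, the tail
    of \<open>y\<close>, and the finite part. Adding 1 to \<open>Q\<close> and to \<open>c\<close>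
    keeps the denominators positive.\<close>
  define \<epsilon> where "\<epsilon> = e / (3 * (Q + 1))"
  have \<epsilon>: "\<epsilon> > 0" using e Q by (simp add: \<epsilon>_def)
  have \<epsilon>Q: "\<epsilon> * Q \<le> e / 3"
    using e Q by (simp add: \<epsilon>_def field_simps)
  obtain c where c: "c \<ge> 0" and fc: "\<And>n m. f n m \<le> \<epsilon> * x n m + c * y m"
    using dom[OF \<epsilon>] by blast
  define \<eta> where "\<eta> = e / (3 * (c + 1))"
  have \<eta>: "\<eta> > 0" using e c by (simp add: \<eta>_def)
  have c\<eta>: "c * \<eta> \<le> e / 3"
    using e c by (simp add: \<eta>_def field_simps)
  obtain F where F: "finite F" "dist (sum y F) (infsum y UNIV) \<le> \<eta>"
    using has_sum_finite_approximation[OF has_sum_infsum[OF ys] \<eta>] by blast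
  \<comment> \<open>\<open>F\<close> holds all but \<open>\<eta>\<close> of the mass of
    \<open>y\<close> and does not depend on \<open>n\<close>. Outside \<open>F\<close>, every finite
    sum of \<open>f n\<close> is at most \<open>\<epsilon> * Q + c * \<eta>\<close>, hence at most
    \<open>2 * e / 3\<close>.\<close>
  have le: "(\<Sum>\<^sub>\<infinity>m. f n m) \<le> sum (f n) F + 2 * e / 3" for n
  proof (rule infsum_le_finite_sums[OF fs])
    fix G :: "'a set" assume G: "finite G"
    have "sum (f n) G \<le> sum (f n) (F \<union> (G - F))"
      using G F f by (intro sum_mono2) auto
    also have "\<dots> = sum (f n) F + sum (f n) (G - F)"
      using G F by (intro sum.union_disjoint) auto
    also have "sum (f n) (G - F) \<le> (\<Sum>m\<in>G - F. \<epsilon> * x n m + c * y m)"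
      by (intro sum_mono fc)
    also have "\<dots> = \<epsilon> * sum (x n) (G - F) + c * sum y (G - F)"
      by (simp add: sum.distrib sum_distrib_left)
    also have "\<dots> \<le> \<epsilon> * Q + c * \<eta>"
    proof (intro add_mono mult_left_mono)
      show "sum (x n) (G - F) \<le> Q"
        using finite_sum_le_infsum[OF xs[of n], of "G - F"] G x xQ[of n] by force
      have "sum y F + sum y (G - F) = sum y (F \<union> (G - F))"
        using G F by (intro sum.union_disjoint[symmetric]) auto
      also have "\<dots> \<le> infsum y UNIV"
        using G F y by (intro finite_sum_le_infsum[OF ys]) auto
      finally show "sum y (G - F) \<le> \<eta>" using F(2) by (simp add: dist_real_def)
    qed (use \<epsilon> c in auto)
    finally show "sum (f n) G \<le> sum (f n) F + 2 * e / 3" using \<epsilon>Q c\<eta> by simp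
  qed
  have "(\<lambda>n. sum (f n) F) \<longlonglongrightarrow> (\<Sum>m\<in>F. 0)" by (intro tendsto_sum lim)
  hence "\<forall>\<^sub>F n in sequentially. sum (f n) F < e / 3"
    using e by (intro order_tendstoD(2)) auto
  thus "\<forall>\<^sub>F n in sequentially. (\<Sum>\<^sub>\<infinity>m. f n m) < e"
  proof eventually_elim
    case (elim n)
    thus ?case using le[of n] by simp
  qed
qed

text \<open>Tychonoff makes the product of the closures of the coordinate ranges compact. The index
  type is countable, so the product is first countable, and compactness yields sequential
  compactness.\<close>

lemma pointwise_convergent_subsequence:
  fixes q :: "nat \<Rightarrow> 'i::countable \<Rightarrow> 'a::heine_borel"
  assumes "\<And>i. bounded (range (\<lambda>n. q n i))"
  shows "\<exists>p r. strict_mono (r :: nat \<Rightarrow> nat) \<and> (\<forall>i. (\<lambda>n. q (r n) i) \<longlonglongrightarrow> p i)"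
proof -
  let ?C = "\<lambda>i. closure (range (\<lambda>n. q n i))"
  have "compactin (product_topology (\<lambda>i. euclidean) UNIV) (PiE UNIV ?C)"
    using assms by (simp add: compactin_PiE)
  hence "compact (PiE UNIV ?C)" by (simp add: euclidean_product_topology)
  hence "seq_compact (PiE UNIV ?C)" by (rule compact_imp_seq_compact)
  moreover have "\<forall>n. q n \<in> PiE UNIV ?C" by (auto intro!: closure_subset[THEN subsetD])
  ultimately obtain p r where r: "strict_mono r" and lim: "(q \<circ> r) \<longlonglongrightarrow> p"
    using seq_compactE by blast
  have "(\<lambda>n. (q \<circ> r) n i) \<longlonglongrightarrow> p i" for i
    using continuous_on_tendsto_compose[OF continuous_on_product_coordinates[of i] lim] by simp
  thus ?thesis using r by (auto simp: o_def)
qed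

lemma h_norm_le_iff:
  assumes s: "s \<ge> 1" and w: "\<And>m. w m > 0" and C: "C \<ge> 0"
  shows "seq_norm (h_space k s w) p \<le> C \<longleftrightarrow> (\<Sum>\<^sub>\<infinity>m. h_term k s w p m) \<le> C powr s"
proof
  assume "seq_norm (h_space k s w) p \<le> C"
  thus "(\<Sum>\<^sub>\<infinity>m. h_term k s w p m) \<le> C powr s"
    using powr_mono2[of s "seq_norm (h_space k s w) p" C] s h_norm_nonneg[where w = w, OF s w, of k p]
    by (simp add: h_norm_powr[where w = w, OF s w])
next
  assume "(\<Sum>\<^sub>\<infinity>m. h_term k s w p m) \<le> C powr s"
  hence "(\<Sum>\<^sub>\<infinity>m. h_term k s w p m) powr (1 / s) \<le> (C powr s) powr (1 / s)"
    using s by (intro powr_mono2 infsum_nonneg h_term_nonneg[where w = w, OF s w]) auto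
  thus "seq_norm (h_space k s w) p \<le> C"
    using s C by (simp add: h_space_def powr_powr)
qed

lemma h_term_tendsto:
  assumes "s \<ge> 1" and "(\<lambda>n. q n m) \<longlonglongrightarrow> p m"
  shows "(\<lambda>n. h_term k s w (q n) m) \<longlonglongrightarrow> h_term k s w p m"
  unfolding h_term_def using assms
  by (intro tendsto_mult tendsto_const tendsto_powr2 tendsto_norm) auto

text \<open>A Fatou argument: each finite partial sum of the limit inherits the bound
  \<open>C powr s\<close>, and for nonnegative terms bounded finite sums give both summability and
  the bound on the total.\<close>

lemma h_ball_closed_pointwise:
  assumes s: "s \<ge> 1" and w: "\<And>m. w m > 0" and C: "C \<ge> 0"
    and q: "\<And>n. q n \<in> seqs (h_space k s w)" "\<And>n. seq_norm (h_space k s w) (q n) \<le> C"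
    and lim: "\<And>m. (\<lambda>n. q n m) \<longlonglongrightarrow> p m"
  shows "p \<in> seqs (h_space k s w)" and "seq_norm (h_space k s w) p \<le> C"
proof -
  have fin: "sum (h_term k s w p) F \<le> C powr s" if "finite F" for F
  proof (rule tendsto_upperbound)
    show "(\<lambda>n. sum (h_term k s w (q n)) F) \<longlonglongrightarrow> sum (h_term k s w p) F"
      by (intro tendsto_sum h_term_tendsto s lim)
    have "sum (h_term k s w (q n)) F \<le> C powr s" for n
    proof -
      have "sum (h_term k s w (q n)) F \<le> (\<Sum>\<^sub>\<infinity>m. h_term k s w (q n) m)"
        using q(1)[of n] that
        by (intro finite_sum_le_infsum h_term_nonneg[where w = w, OF s w]) (simp_all add: h_seqs_iff[where w = w, OF s w])
      also have "\<dots> \<le> C powr s" using q(2)[of n] by (simp add: h_norm_le_iff[where w = w, OF s w C])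
      finally show ?thesis .
    qed
    thus "\<forall>\<^sub>F n in sequentially. sum (h_term k s w (q n)) F \<le> C powr s" by simp
  qed simp
  have sum: "h_term k s w p summable_on UNIV"
    by (rule nonneg_bdd_above_summable_on)
       (use fin in \<open>auto intro!: bdd_aboveI2 h_term_nonneg[where w = w, OF s w]\<close>)
  thus "p \<in> seqs (h_space k s w)" by (simp add: h_seqs_iff[where w = w, OF s w])
  show "seq_norm (h_space k s w) p \<le> C"
    unfolding h_norm_le_iff[where w = w, OF s w C] by (rule infsum_le_finite_sums[OF sum]) (rule fin)
qed

text \<open>The domination is uniform in \<open>p\<close>, with \<open>y\<close> fixed. One value of
  \<open>\<epsilon>\<close> already gives continuity; letting \<open>\<epsilon>\<close> be
  arbitrarily small upgrades pointwise convergence on source balls to convergence in the target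
  norm.\<close>

lemma h_compact_embeddingI:
  fixes s t k l :: real and w w' y :: "int \<Rightarrow> real"
  assumes s: "s \<ge> 1" and t: "t \<ge> 1" and w: "\<And>m. w m > 0" and w': "\<And>m. w' m > 0"
    and y: "\<And>m. y m \<ge> 0" and ys: "y summable_on UNIV"
    and dom: "\<And>\<epsilon>. \<epsilon> > 0 \<Longrightarrow>
      \<exists>c\<ge>0. \<forall>p m. h_term l t w' p m \<le> \<epsilon> * h_term k s w p m + c * y m"
  shows "compact_embedding (h_space k s w) (h_space l t w')"
proof -
  let ?X = "h_space k s w" and ?Y = "h_space l t w'"
  interpret Y: Metric_space "seqs ?Y" "seq_dist ?Y" by (rule h_Metric_space[where w = w', OF t w'])
  obtain c where c: "c \<ge> 0" and le: "\<And>p m. h_term l t w' p m \<le> h_term k s w p m + c * y m"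
    using dom[of 1] by auto
  have emb: "continuous_embedding ?X ?Y"
  proof (rule h_continuous_embeddingI[where w = w and w' = w', OF s t w w', where M = "1 + c * infsum y UNIV"])
    fix p assume p: "p \<in> seqs ?X" and 1: "(\<Sum>\<^sub>\<infinity>m. h_term k s w p m) \<le> 1"
    have ps: "h_term k s w p summable_on UNIV" using p by (simp add: h_seqs_iff[where w = w, OF s w])
    have S: "(\<lambda>m. h_term k s w p m + c * y m) summable_on UNIV"
      by (intro summable_on_add ps summable_on_cmult_right ys)
    have T: "h_term l t w' p summable_on UNIV"
      by (rule summable_on_comparison_test[OF S]) (use le h_term_nonneg[where w = w', OF t w'] in auto)
    have "(\<Sum>\<^sub>\<infinity>m. h_term l t w' p m) \<le> (\<Sum>\<^sub>\<infinity>m. h_term k s w p m + c * y m)"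
      by (intro infsum_mono T S le)
    also have "\<dots> = (\<Sum>\<^sub>\<infinity>m. h_term k s w p m) + c * infsum y UNIV"
      by (simp add: infsum_add ps summable_on_cmult_right ys infsum_cmult_right')
    finally show "p \<in> seqs ?Y \<and> (\<Sum>\<^sub>\<infinity>m. h_term l t w' p m) \<le> 1 + c * infsum y UNIV"
      using T 1 by (simp add: h_seqs_iff[where w = w', OF t w'])
  qed
  hence sub: "seqs ?X \<subseteq> seqs ?Y" by (simp add: continuous_embedding_def)
  \<comment> \<open>The closed source ball is itself compact in the target, because pointwise limits
    of its sequences stay in it.\<close>
  have ball: "compactin Y.mtopology {p \<in> seqs ?X. seq_norm ?X p \<le> C}" if C: "C \<ge> 0" for C
    unfolding Y.compactin_sequentially
  proof (intro conjI allI impI)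
    let ?K = "{p \<in> seqs ?X. seq_norm ?X p \<le> C}"
    show "?K \<subseteq> seqs ?Y" using sub by auto
    fix q :: "nat \<Rightarrow> cseq" assume "range q \<subseteq> ?K"
    hence q: "q n \<in> seqs ?X" "seq_norm ?X (q n) \<le> C" for n by auto
    have "bounded (range (\<lambda>n. q n m))" for m
    proof -
      \<comment> \<open>A single summand is at most the whole sum; solving for the coordinate gives
        a bound independent of \<open>n\<close>.\<close>
      have "cmod (q n m) \<le> (C powr s / h_wt k s w m) powr (1 / s)" for n
      proof -
        have "h_term k s w (q n) m \<le> (\<Sum>\<^sub>\<infinity>m. h_term k s w (q n) m)"
          using finite_sum_le_infsum[of "h_term k s w (q n)" UNIV "{m}"] q(1)[of n]
            h_term_nonneg[where w = w, OF s w] by (simp add: h_seqs_iff[where w = w, OF s w])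
        also have "\<dots> \<le> C powr s" using q(2) by (simp add: h_norm_le_iff[where w = w, OF s w C])
        finally have "cmod (q n m) powr s \<le> C powr s / h_wt k s w m"
          using h_wt_pos[where w = w, OF s w, of k m] by (simp add: h_term_wt[where w = w, OF s w] field_simps)
        hence "(cmod (q n m) powr s) powr (1 / s) \<le> (C powr s / h_wt k s w m) powr (1 / s)"
          using s by (intro powr_mono2) auto
        thus ?thesis using s by (simp add: powr_powr)
      qed
      thus ?thesis by (auto simp: bounded_iff)
    qed
    then obtain p r where r: "strict_mono (r :: nat \<Rightarrow> nat)"
      and lim: "\<And>m. (\<lambda>n. q (r n) m) \<longlonglongrightarrow> p m"
      using pointwise_convergent_subsequence[of q] by blast
    have p: "p \<in> seqs ?X" "seq_norm ?X p \<le> C"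
      using h_ball_closed_pointwise[where w = w, OF s w C, of "\<lambda>n. q (r n)" k p] q lim by auto
    define d where "d n = (\<lambda>m. q (r n) m - p m)" for n
    have dX: "d n \<in> seqs ?X" for n unfolding d_def by (intro h_diff[where w = w, OF s w] q p)
    \<comment> \<open>The differences stay in the source ball of radius \<open>2 * C\<close>, which
      provides the uniform mass bound for the domination lemma.\<close>
    have "seq_norm ?X (d n) \<le> 2 * C" for n
      using h_add(2)[where w = w, OF s w q(1) h_scale(1)[where w = w, OF s w p(1)], of "r n" "-1"] p q(2)[of "r n"]
        h_scale(2)[where w = w, OF s w p(1), of "-1"] by (simp add: d_def)
    hence dQ: "(\<Sum>\<^sub>\<infinity>m. h_term k s w (d n) m) \<le> (2 * C) powr s" for n
      using C h_norm_le_iff[where w = w, OF s w, of "2 * C"] by simp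
    have d0: "(\<lambda>n. h_term l t w' (d n) m) \<longlonglongrightarrow> 0" for m
    proof -
      have "(\<lambda>n. d n m) \<longlonglongrightarrow> 0" unfolding d_def using lim[of m] by (simp add: LIM_zero)
      from h_term_tendsto[where q = d and p = "\<lambda>_. 0", OF t this, of l w'] show ?thesis
        by (simp add: h_term_def)
    qed
    have "(\<lambda>n. \<Sum>\<^sub>\<infinity>m. h_term l t w' (d n) m) \<longlonglongrightarrow> 0"
    proof (rule infsum_tendsto_zero_of_domination[OF _ _ _ _ dQ y ys _ d0])
      show "h_term l t w' (d n) summable_on UNIV" for n
        using subsetD[OF sub dX] by (simp add: h_seqs_iff[where w = w', OF t w'])
      show "h_term k s w (d n) summable_on UNIV" for n
        using dX by (simp add: h_seqs_iff[where w = w, OF s w])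
      show "\<exists>c\<ge>0. \<forall>n m. h_term l t w' (d n) m \<le> \<epsilon> * h_term k s w (d n) m + c * y m"
        if "\<epsilon> > 0" for \<epsilon> using dom[OF that] by blast
    qed (rule h_term_nonneg[where w = w, OF s w] h_term_nonneg[where w = w', OF t w'])+
    hence "(\<lambda>n. (\<Sum>\<^sub>\<infinity>m. h_term l t w' (d n) m) powr (1 / t)) \<longlonglongrightarrow> 0"
      using t by (intro tendsto_zero_powrI[OF _ tendsto_const] always_eventually allI infsum_nonneg
          h_term_nonneg[where w = w', OF t w']) auto
    hence dist0: "(\<lambda>n. seq_dist ?Y (q (r n)) p) \<longlonglongrightarrow> 0"
      by (simp add: seq_dist_def h_space_def d_def)
    have "limitin Y.mtopology (q \<circ> r) p sequentially"
      unfolding Y.limitin_metric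
    proof (intro conjI allI impI)
      show "p \<in> seqs ?Y" using p sub by auto
      fix e :: real assume "e > 0"
      from order_tendstoD(2)[OF dist0 this]
      show "\<forall>\<^sub>F n in sequentially. (q \<circ> r) n \<in> seqs ?Y \<and> seq_dist ?Y ((q \<circ> r) n) p < e"
        using q(1) sub by (auto elim!: eventually_mono)
    qed
    thus "\<exists>p r. p \<in> ?K \<and> strict_mono r \<and> limitin Y.mtopology (q \<circ> r) p sequentially"
      using p r by blast
  qed
  have "compactin Y.mtopology (Y.mtopology closure_of B)" if B: "seq_bounded ?X B" for B
  proof -
    obtain C where BX: "B \<subseteq> seqs ?X" and C: "\<And>p. p \<in> B \<Longrightarrow> seq_norm ?X p \<le> C"
      using B by (auto simp: seq_bounded_def)
    \<comment> \<open>The absolute value covers an empty \<open>B\<close>, for which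
      \<open>C\<close> may be negative.\<close>
    let ?K = "{p \<in> seqs ?X. seq_norm ?X p \<le> \<bar>C\<bar>}"
    have K: "compactin Y.mtopology ?K" by (rule ball) simp
    have "B \<subseteq> ?K" using BX C by force
    \<comment> \<open>A compact set in a Hausdorff space is closed, so the ball contains the closure
      of \<open>B\<close>, which is then a closed subset of a compact set.\<close>
    hence "Y.mtopology closure_of B \<subseteq> ?K"
      by (rule closure_of_minimal) (rule compactin_imp_closedin[OF Y.Hausdorff_space_mtopology K])
    thus ?thesis by (rule closed_compactin[OF K]) simp
  qed
  thus ?thesis
    using emb by (simp add: compact_embedding_def compact_operator_def continuous_embedding_def
        continuous_linear_operator_def seq_topology_def)
qed

section \<open>Young's inequality and summability of the weight powers\<close>

text \<open>Replacing the smaller of \<open>y\<close> and \<open>\<delta> * x\<close> by the larger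
  bounds the product by one of the two summands alone; the other is nonnegative. A small
  \<open>\<delta>\<close> makes the coefficient of \<open>x\<close> small.\<close>

lemma Young_powr:
  fixes x y \<delta> \<theta> :: real
  assumes "x \<ge> 0" "y \<ge> 0" "\<delta> > 0" "0 < \<theta>" "\<theta> < 1"
  shows "x powr \<theta> * y powr (1 - \<theta>) \<le> \<delta> powr (1 - \<theta>) * x + \<delta> powr (- \<theta>) * y"
proof (cases "y \<le> \<delta> * x")
  case True
  have "x powr \<theta> * y powr (1 - \<theta>) \<le> x powr \<theta> * (\<delta> * x) powr (1 - \<theta>)"
    using True assms by (intro mult_left_mono powr_mono2) auto
  also have "\<dots> = \<delta> powr (1 - \<theta>) * (x powr \<theta> * x powr (1 - \<theta>))"
    using assms by (simp add: powr_mult)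
  also have "\<dots> = \<delta> powr (1 - \<theta>) * x"
    using assms by (simp flip: powr_add)
  finally show ?thesis using assms by (smt (verit) mult_nonneg_nonneg powr_ge_zero)
next
  case False
  have "x powr \<theta> * y powr (1 - \<theta>) \<le> (y / \<delta>) powr \<theta> * y powr (1 - \<theta>)"
    using False assms by (intro mult_right_mono powr_mono2) (auto simp: field_simps)
  also have "\<dots> = \<delta> powr (- \<theta>) * (y powr \<theta> * y powr (1 - \<theta>))"
    using assms by (simp add: powr_divide powr_minus field_simps)
  also have "\<dots> = \<delta> powr (- \<theta>) * y"
    using assms by (simp flip: powr_add)
  finally show ?thesis using assms by (smt (verit) mult_nonneg_nonneg powr_ge_zero)
qed

text \<open>The integers are the union of two copies of the naturals, on which \<open>f\<close>
  takes the same values; the overlap at 0 is harmless for summability.\<close>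

lemma summable_on_int_even:
  fixes f :: "int \<Rightarrow> real"
  assumes "\<And>m. f (- m) = f m" and "(\<lambda>n. f (int n)) summable_on UNIV"
  shows "f summable_on UNIV"
proof -
  have "f summable_on range int" "f summable_on range (\<lambda>n. - int n)"
    using assms by (subst summable_on_reindex; simp add: inj_on_def o_def)+
  moreover have "UNIV = range int \<union> range (\<lambda>n. - int n)"
    by (auto simp: image_iff) (metis int_cases2)
  ultimately show ?thesis by (metis summable_on_union)
qed

lemma summable_on_bracket_powr:
  fixes s a :: real
  assumes "s > 0" and "s * a > 1"
  shows "(\<lambda>m::int. (1 + \<bar>real_of_int m\<bar> powr s) powr - a) summable_on UNIV"
proof (rule summable_on_int_even)
  have a: "a > 0" using assms by (smt (verit) mult_nonneg_nonpos)
  have "summable (\<lambda>n. (1 + real n powr s) powr - a)"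
  proof (rule summable_comparison_test_ev)
    show "summable (\<lambda>n. real n powr - (s * a))"
      using assms by (subst summable_real_powr_iff) simp
    \<comment> \<open>The comparison starts after \<open>n = 0\<close>: there the left side is 1,
      while \<open>0 powr - (s * a)\<close> is 0.\<close>
    show "\<forall>\<^sub>F n in sequentially. norm ((1 + real n powr s) powr - a) \<le> real n powr - (s * a)"
      using eventually_gt_at_top[of 0]
    proof eventually_elim
      case (elim n)
      hence "(1 + real n powr s) powr - a \<le> (real n powr s) powr - a"
        using a by (intro powr_mono2') auto
      thus ?case by (simp add: powr_powr)
    qed
  qed
  thus "(\<lambda>n. (1 + \<bar>real_of_int (int n)\<bar> powr s) powr - a) summable_on UNIV"
    by (subst summable_on_UNIV_nonneg_real_iff) simp_all
qed simp

section \<open>The compact and the continuous embedding\<close>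

lemma l_term_eq: "h_term 0 s w p m = w m * cmod (p m) powr s"
proof -
  \<comment> \<open>The base must be nonzero because \<open>0 powr 0 = 0\<close>.\<close>
  have "1 + \<bar>real_of_int m\<bar> powr s \<noteq> 0"
    using powr_ge_zero[of "\<bar>real_of_int m\<bar>" s] by linarith
  thus ?thesis by (simp add: h_term_def)
qed

lemma compact_embedding_h_l:
  fixes s t k c1 :: real and w w' :: "int \<Rightarrow> real"
  assumes s: "s \<ge> 1" and t: "t \<ge> 1" and st: "s > t"
    and w: "\<And>m. w m > 0" and w': "\<And>m. w' m > 0"
    and c1: "c1 > 0" "\<And>m. c1 \<le> w m powr (t / s) / w' m"
    and k: "k > (s - t) / (s * t)"
  shows "compact_embedding (h_space k s w) (l_space t w')"
  unfolding l_space_def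
proof (rule h_compact_embeddingI[where w = w and w' = w', OF s t w w'])
  \<comment> \<open>The exponent solves \<open>a * (1 - ?\<theta>) = k * ?\<theta>\<close>, so that
    the powers of \<open>b m\<close> cancel in the interpolation below.\<close>
  define a where "a = k * t / (s - t)"
  define b where "b m = 1 + \<bar>real_of_int m\<bar> powr s" for m
  let ?\<theta> = "t / s"
  have \<theta>: "0 < ?\<theta>" "?\<theta> < 1" using s t st by auto
  have b: "b m > 0" for m using powr_ge_zero[of "\<bar>real_of_int m\<bar>" s] by (simp add: b_def add_pos_nonneg)
  have "s * a > 1" using k s t st by (simp add: a_def field_simps)
  thus "(\<lambda>m. b m powr - a) summable_on UNIV"
    unfolding b_def using s by (intro summable_on_bracket_powr) auto
  have interp: "h_term 0 t w' p m
      \<le> 1 / c1 * (h_term k s w p m powr ?\<theta> * (b m powr - a) powr (1 - ?\<theta>))" for p m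
  proof -
    have e: "- a * (1 - ?\<theta>) = - (k * ?\<theta>)"
      using s st by (simp add: a_def field_simps)
    have "w' m * cmod (p m) powr t \<le> 1 / c1 * (w m powr ?\<theta> * cmod (p m) powr t)"
      using c1(1) c1(2)[of m] w'[of m] mult_right_mono[of "c1 * w' m" "w m powr ?\<theta>" "cmod (p m) powr t"]
      by (simp add: field_simps)
    also have "w m powr ?\<theta> * cmod (p m) powr t
        = h_term k s w p m powr ?\<theta> * (b m powr - a) powr (1 - ?\<theta>)"
      using s w[of m] b[of m] unfolding powr_powr e
      by (simp add: h_term_def b_def powr_mult powr_powr powr_minus)
    finally show ?thesis by (simp add: l_term_eq)
  qed
  show "\<exists>c\<ge>0. \<forall>p m. h_term 0 t w' p m \<le> \<epsilon> * h_term k s w p m + c * b m powr - a"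
    if \<epsilon>: "\<epsilon> > 0" for \<epsilon>
  proof -
    \<comment> \<open>Chosen so that \<open>\<delta> powr (1 - ?\<theta>)\<close>, multiplied by the
      factor \<open>1 / c1\<close> from \<open>interp\<close>, is exactly
      \<open>\<epsilon>\<close>.\<close>
    define \<delta> where "\<delta> = (c1 * \<epsilon>) powr (1 / (1 - ?\<theta>))"
    have \<delta>: "\<delta> > 0" "\<delta> powr (1 - ?\<theta>) = c1 * \<epsilon>"
      using \<epsilon> c1 st by (simp_all add: \<delta>_def powr_powr)
    have "h_term 0 t w' p m
        \<le> \<epsilon> * h_term k s w p m + (1 / c1 * \<delta> powr - ?\<theta>) * b m powr - a" for p m
    proof -
      have "1 / c1 * (h_term k s w p m powr ?\<theta> * (b m powr - a) powr (1 - ?\<theta>))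
          \<le> 1 / c1 * (\<delta> powr (1 - ?\<theta>) * h_term k s w p m + \<delta> powr - ?\<theta> * b m powr - a)"
        using c1 \<delta> \<theta> by (intro mult_left_mono Young_powr h_term_nonneg[where w = w, OF s w]) auto
      also have "\<dots> = \<epsilon> * h_term k s w p m + (1 / c1 * \<delta> powr - ?\<theta>) * b m powr - a"
        using c1 unfolding \<delta>(2) by (simp add: field_simps)
      finally show ?thesis using interp[of p m] by linarith
    qed
    thus ?thesis using c1 by (intro exI[of _ "1 / c1 * \<delta> powr - ?\<theta>"]) auto
  qed
qed simp

text \<open>On the unit ball of the source every summand \<open>u\<close> lies between 0 and 1, so
  \<open>u powr (s / t) \<le> u\<close> as \<open>s / t > 1\<close>. The weight ratio contributes
  the factor \<open>c2 powr (s / t)\<close>.\<close>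

lemma continuous_embedding_l_l:
  fixes s t c2 :: real and w w' :: "int \<Rightarrow> real"
  assumes s: "s \<ge> 1" and t: "t \<ge> 1" and st: "s > t"
    and w: "\<And>m. w m > 0" and w': "\<And>m. w' m > 0"
    and c2: "c2 > 0" "\<And>m. w m powr (t / s) / w' m \<le> c2"
  shows "continuous_embedding (l_space t w') (l_space s w)"
  unfolding l_space_def
proof (rule h_continuous_embeddingI[where w = w' and w' = w, OF t s w' w, where M = "c2 powr (s / t)"])
  fix p assume p: "p \<in> seqs (h_space 0 t w')" and 1: "(\<Sum>\<^sub>\<infinity>m. h_term 0 t w' p m) \<le> 1"
  have ps: "h_term 0 t w' p summable_on UNIV" using p by (simp add: h_seqs_iff[where w = w', OF t w'])
  have le: "h_term 0 s w p m \<le> c2 powr (s / t) * h_term 0 t w' p m" for m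
  proof -
    let ?u = "h_term 0 t w' p m"
    have u: "0 \<le> ?u" "?u \<le> 1"
      using finite_sum_le_infsum[OF ps, of "{m}"] h_term_nonneg[where w = w', OF t w'] 1 by force+
    \<comment> \<open>Written as a power with exponent \<open>s / t\<close>, the summand shows the
      quantity \<open>w m powr (t / s)\<close> that \<open>c2\<close> controls.\<close>
    have "h_term 0 s w p m = (w m powr (t / s) * cmod (p m) powr t) powr (s / t)"
      using s t w[of m] by (simp add: l_term_eq powr_mult powr_powr)
    also have "\<dots> \<le> (c2 * ?u) powr (s / t)"
      using s t c2(2)[of m] w'[of m] mult_right_mono[of "w m powr (t / s)" "c2 * w' m" "cmod (p m) powr t"]
      by (intro powr_mono2) (auto simp: l_term_eq field_simps)
    also have "\<dots> = c2 powr (s / t) * ?u powr (s / t)"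
      using u c2 by (simp add: powr_mult)
    also have "\<dots> \<le> c2 powr (s / t) * ?u powr 1"
      using u st t by (intro mult_left_mono powr_mono') auto
    finally show ?thesis using u by simp
  qed
  have S: "(\<lambda>m. c2 powr (s / t) * h_term 0 t w' p m) summable_on UNIV"
    by (intro summable_on_cmult_right ps)
  have T: "h_term 0 s w p summable_on UNIV"
    by (rule summable_on_comparison_test[OF S]) (use le h_term_nonneg[where w = w, OF s w] in auto)
  have "(\<Sum>\<^sub>\<infinity>m. h_term 0 s w p m) \<le> (\<Sum>\<^sub>\<infinity>m. c2 powr (s / t) * h_term 0 t w' p m)"
    by (intro infsum_mono T S le)
  also have "\<dots> \<le> c2 powr (s / t)"
    using mult_left_mono[OF 1, of "c2 powr (s / t)"] by (simp add: infsum_cmult_right')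
  finally show "p \<in> seqs (h_space 0 s w) \<and> (\<Sum>\<^sub>\<infinity>m. h_term 0 s w p m) \<le> c2 powr (s / t)"
    using T by (simp add: h_seqs_iff[where w = w, OF s w])
qed

theorem theorem2:
  fixes s t k :: real and w w' :: "int \<Rightarrow> real"
  assumes "s \<ge> 1" and "t \<ge> 1" and "s > t"
    and "\<And>m. w m > 0" and "\<And>m. w' m > 0"
    and "\<exists>c1>0. \<exists>c2>0. \<forall>m. c1 \<le> w m powr (t / s) / w' m \<and> w m powr (t / s) / w' m \<le> c2"
    and "k > (s - t) / (s * t)"
  shows "compact_embedding (h_space k s w) (l_space t w')
       \<and> continuous_embedding (l_space t w') (l_space s w)"
proof -
  obtain c1 c2 where "c1 > 0" "c2 > 0"
    and "\<And>m. c1 \<le> w m powr (t / s) / w' m" "\<And>m. w m powr (t / s) / w' m \<le> c2"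
    using assms(6) by blast
  thus ?thesis
    using compact_embedding_h_l[where w = w and w' = w', OF assms(1-5)] continuous_embedding_l_l[where w = w and w' = w', OF assms(1-5)] assms(7)
    by blast
qed

end
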